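(* Let $N\ge2$, let $u$ be a polynomial of degree at most $N+1$, let $x_1<\dots<x_N$ be the $N$ roots of $T_N$, and let $u_N$ be the polynomial of degree at most $N$ with $u_N(-1)=u(-1)$ and $u_N'(x_k)=u'(x_k)$ for $k=1,\dots,N$. Then there is a constant $c$ such that for all $x$ $$(u-u_N)(x) = c\left[\frac{N}{N^2-1}(x^2-1)U_{N-1}(x) - \frac{xT_N(x)+(-1)^N}{N^2-1}\right].$$
   Context: $T_n$ and $U_n$ are the Chebyshev polynomials of the first and second kind: $T_n(\cos\theta)=\cos n\theta$, $U_n(\cos\theta)=\sin((n+1)\theta)/\sin\theta$. *)

theory Defs
  imports Complex_Main "HOL-Computational_Algebra.Polynomial"
begin

lemma real_poly_eqI_interval:
  fixes p q :: "real poly"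
  assumes "\<And>x. -1 < x \<Longrightarrow> x < 1 \<Longrightarrow> poly p x = poly q x"
  shows "p = q"
proof (rule ccontr)
  assume "p \<noteq> q"
  then have "finite {x. poly (p - q) x = 0}"
    by (intro poly_roots_finite) simp
  moreover have "{-1<..<1} \<subseteq> {x. poly (p - q) x = 0}"
    using assms by auto
  ultimately have "finite {-1<..<1::real}"
    by (rule finite_subset[rotated])
  then show False
    by (simp add: infinite_Ioo)
qed

lemma interval_cos:
  fixes x :: real
  assumes "-1 < x" "x < 1"
  obtains \<theta> where "x = cos \<theta>" "sin \<theta> \<noteq> 0"
proof
  show "x = cos (arccos x)"
    using assms by simp
  show "sin (arccos x) \<noteq> 0"
    using sin_arccos_nonzero[OF assms] .
qed

definition chebyshev_T :: "nat \<Rightarrow> real poly" where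
  "chebyshev_T n = (THE p. \<forall>\<theta>. poly p (cos \<theta>) = cos (real n * \<theta>))"

text \<open>The identity for \<open>chebyshev_U\<close> is only imposed where the quotient is meaningful: at
  \<open>sin \<theta> = 0\<close> it would force the value \<open>0\<close> by the convention for division by zero.\<close>

definition chebyshev_U :: "nat \<Rightarrow> real poly" where
  "chebyshev_U n =
     (THE p. \<forall>\<theta>. sin \<theta> \<noteq> 0 \<longrightarrow> poly p (cos \<theta>) = sin (real (n + 1) * \<theta>) / sin \<theta>)"

lemma chebyshev_T_exists:
  "\<exists>p::real poly. \<forall>\<theta>. poly p (cos \<theta>) = cos (real n * \<theta>)"
proof (induction n rule: induct_nat_012)
  case 0
  show ?case by (rule exI[of _ 1]) simp
next
  case 1
  show ?case by (rule exI[of _ "[:0, 1:]"]) simp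
next
  case (ge2 n)
  then obtain p q :: "real poly" where
    p: "\<And>\<theta>. poly p (cos \<theta>) = cos (real n * \<theta>)" and
    q: "\<And>\<theta>. poly q (cos \<theta>) = cos (real (Suc n) * \<theta>)"
    by blast
  have "cos (real (Suc (Suc n)) * \<theta>) =
        2 * cos \<theta> * cos (real (Suc n) * \<theta>) - cos (real n * \<theta>)" for \<theta> :: real
    using cos_add[of "real (Suc n) * \<theta>" \<theta>] cos_diff[of "real (Suc n) * \<theta>" \<theta>]
    by (simp add: algebra_simps)
  then show ?case
    by (intro exI[of _ "[:0, 2:] * q - p"]) (simp add: p q)
qed

lemma chebyshev_U_exists:
  "\<exists>p::real poly. \<forall>\<theta>. sin \<theta> \<noteq> 0 \<longrightarrow> poly p (cos \<theta>) = sin (real (n + 1) * \<theta>) / sin \<theta>"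
proof (induction n rule: induct_nat_012)
  case 0
  show ?case by (rule exI[of _ 1]) simp
next
  case 1
  show ?case by (rule exI[of _ "[:0, 2:]"]) (simp add: sin_double)
next
  case (ge2 n)
  then obtain p q :: "real poly" where
    p: "\<And>\<theta>. sin \<theta> \<noteq> 0 \<Longrightarrow> poly p (cos \<theta>) = sin (real (n + 1) * \<theta>) / sin \<theta>" and
    q: "\<And>\<theta>. sin \<theta> \<noteq> 0 \<Longrightarrow> poly q (cos \<theta>) = sin (real (Suc n + 1) * \<theta>) / sin \<theta>"
    by blast
  have *: "sin (real (Suc (Suc n) + 1) * \<theta>) =
        2 * cos \<theta> * sin (real (Suc n + 1) * \<theta>) - sin (real (n + 1) * \<theta>)" for \<theta> :: real
    using sin_add[of "real (Suc n + 1) * \<theta>" \<theta>] sin_diff[of "real (Suc n + 1) * \<theta>" \<theta>]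
    by (simp add: algebra_simps)
  show ?case
    by (intro exI[of _ "[:0, 2:] * q - p"] allI impI, subst *)
      (simp add: p q diff_divide_distrib del: of_nat_Suc of_nat_add)
qed

lemma chebyshev_T_unique:
  "\<exists>!p::real poly. \<forall>\<theta>. poly p (cos \<theta>) = cos (real n * \<theta>)"
proof (rule ex_ex1I[OF chebyshev_T_exists])
  fix p q :: "real poly"
  assume "\<forall>\<theta>. poly p (cos \<theta>) = cos (real n * \<theta>)"
    and "\<forall>\<theta>. poly q (cos \<theta>) = cos (real n * \<theta>)"
  then show "p = q"
    by (intro real_poly_eqI_interval) (metis interval_cos)
qed

lemma chebyshev_U_unique:
  "\<exists>!p::real poly. \<forall>\<theta>. sin \<theta> \<noteq> 0 \<longrightarrow> poly p (cos \<theta>) = sin (real (n + 1) * \<theta>) / sin \<theta>"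
proof (rule ex_ex1I[OF chebyshev_U_exists])
  fix p q :: "real poly"
  assume "\<forall>\<theta>. sin \<theta> \<noteq> 0 \<longrightarrow> poly p (cos \<theta>) = sin (real (n + 1) * \<theta>) / sin \<theta>"
    and "\<forall>\<theta>. sin \<theta> \<noteq> 0 \<longrightarrow> poly q (cos \<theta>) = sin (real (n + 1) * \<theta>) / sin \<theta>"
  then show "p = q"
    by (intro real_poly_eqI_interval) (metis interval_cos)
qed

lemma poly_chebyshev_T_cos: "poly (chebyshev_T n) (cos \<theta>) = cos (real n * \<theta>)"
  using theI'[OF chebyshev_T_unique[of n]] unfolding chebyshev_T_def by blast

lemma poly_chebyshev_U_cos:
  "sin \<theta> \<noteq> 0 \<Longrightarrow> poly (chebyshev_U n) (cos \<theta>) = sin (real (n + 1) * \<theta>) / sin \<theta>"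
  using theI'[OF chebyshev_U_unique[of n]] unfolding chebyshev_U_def by blast

end

theory Submission
  imports Defs
begin

text \<open>The derivative of \<open>u - u\<^sub>N\<close> has degree at most \<open>N\<close> and vanishes at the \<open>N\<close> roots of
  \<open>T\<^sub>N\<close>, so it is \<open>c T\<^sub>N\<close>. Substituting \<open>x = cos \<theta>\<close>, the bracket becomes
  \<open>-(N sin \<theta> sin (N\<theta>) + cos \<theta> cos (N\<theta>) + (-1)\<^sup>N) / (N\<^sup>2 - 1)\<close>, and differentiating in \<open>\<theta>\<close> shows
  that it is the primitive of \<open>T\<^sub>N\<close> that vanishes at \<open>-1\<close>.\<close>

lemma chebyshev_T_eqI:
  assumes "\<And>\<theta>. poly p (cos \<theta>) = cos (real n * \<theta>)"
  shows "chebyshev_T n = p"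
  using chebyshev_T_unique[of n] assms poly_chebyshev_T_cos by blast

text \<open>The addition formulas for cos ((n + 1) \<theta> \<plusminus> \<theta>) add up to this.
  The defining identity does not display a degree; the recurrence makes one accessible by
  induction.\<close>

lemma chebyshev_T_Suc_Suc:
  "chebyshev_T (Suc (Suc n)) = [:0, 2:] * chebyshev_T (Suc n) - chebyshev_T n"
proof (rule chebyshev_T_eqI)
  fix \<theta> :: real
  have "cos (real (Suc (Suc n)) * \<theta>) =
        2 * cos \<theta> * cos (real (Suc n) * \<theta>) - cos (real n * \<theta>)"
    using cos_add[of "real (Suc n) * \<theta>" \<theta>] cos_diff[of "real (Suc n) * \<theta>" \<theta>]
    by (simp add: algebra_simps)
  then show "poly ([:0, 2:] * chebyshev_T (Suc n) - chebyshev_T n) (cos \<theta>) =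
        cos (real (Suc (Suc n)) * \<theta>)"
    by (simp add: poly_chebyshev_T_cos)
qed

lemma degree_chebyshev_T_le: "degree (chebyshev_T n) \<le> n"
proof (induction n rule: induct_nat_012)
  case 0
  have "chebyshev_T 0 = 1" by (rule chebyshev_T_eqI) simp
  then show ?case by simp
next
  case 1
  have "chebyshev_T (Suc 0) = [:0, 1:]" by (rule chebyshev_T_eqI) simp
  then show ?case by simp
next
  case (ge2 n)
  have "degree ([:0, 2:] * chebyshev_T (Suc n)) \<le> Suc (Suc n)"
    using degree_mult_le[of "[:0, 2:]" "chebyshev_T (Suc n)"] ge2 by simp
  then show ?case
    unfolding chebyshev_T_Suc_Suc using ge2 by (intro degree_diff_le) auto
qed

lemma poly_chebyshev_T_1: "poly (chebyshev_T n) 1 = 1"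
  using poly_chebyshev_T_cos[of n 0] by simp

lemma poly_chebyshev_T_minus_1: "poly (chebyshev_T n) (-1) = (-1) ^ n"
  using poly_chebyshev_T_cos[of n pi] by (simp add: cos_npi)

text \<open>The bracket of the theorem as a polynomial, so that \<open>pderiv\<close> applies to it.
  For \<open>n = 1\<close> both denominators are 0 and it collapses to 0.\<close>

definition chebyshev_T_primitive :: "nat \<Rightarrow> real poly" where
  "chebyshev_T_primitive n =
     smult (real n / (real n ^ 2 - 1)) ([:-1, 0, 1:] * chebyshev_U (n - 1))
     - smult (1 / (real n ^ 2 - 1)) ([:0, 1:] * chebyshev_T n + [:(-1) ^ n:])"

lemma poly_chebyshev_T_primitive:
  "poly (chebyshev_T_primitive n) y =
     real n / (real n ^ 2 - 1) * (y ^ 2 - 1) * poly (chebyshev_U (n - 1)) y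
     - (y * poly (chebyshev_T n) y + (-1) ^ n) / (real n ^ 2 - 1)"
proof -
  have "poly [:-1, 0, 1:] y = y ^ 2 - 1"
    by (simp add: power2_eq_square)
  then show ?thesis
    unfolding chebyshev_T_primitive_def poly_diff poly_smult poly_mult poly_add
    by simp
qed

text \<open>At -1 the factor \<open>y ^ 2 - 1\<close> vanishes, and the constant
  \<open>(-1) ^ n\<close> cancels the product of -1 with the value \<open>(-1) ^ n\<close> of
  \<open>chebyshev_T n\<close>.\<close>

lemma poly_chebyshev_T_primitive_minus_1: "poly (chebyshev_T_primitive n) (-1) = 0"
  unfolding poly_chebyshev_T_primitive by (simp add: poly_chebyshev_T_minus_1)

lemma poly_chebyshev_T_primitive_cos:
  assumes "n \<ge> 1"
  shows "poly (chebyshev_T_primitive n) (cos \<theta>) =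
    - (real n * sin \<theta> * sin (real n * \<theta>) + cos \<theta> * cos (real n * \<theta>) + (-1) ^ n)
      / (real n ^ 2 - 1)"
proof -
  have "(cos \<theta> ^ 2 - 1) * poly (chebyshev_U (n - 1)) (cos \<theta>) = - (sin \<theta> * sin (real n * \<theta>))"
  \<comment> \<open>\<open>chebyshev_U\<close> is characterised only where sin \<theta> is nonzero.
    Elsewhere the factor cos^2 - 1 = -sin^2 makes both sides 0, so the identity holds for every
    \<theta> and may be differentiated.\<close>
  proof (cases "sin \<theta> = 0")
    case True
    then show ?thesis by (simp add: cos_squared_eq)
  next
    case False
    then have "poly (chebyshev_U (n - 1)) (cos \<theta>) = sin (real n * \<theta>) / sin \<theta>"
      using assms poly_chebyshev_U_cos[OF False, of "n - 1"] by simp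
    then show ?thesis
      using False by (simp add: cos_squared_eq) (simp add: power2_eq_square)
  qed
  then show ?thesis
    unfolding poly_chebyshev_T_primitive mult.assoc
    by (simp add: poly_chebyshev_T_cos diff_divide_distrib add_divide_distrib)
qed

lemma pderiv_chebyshev_T_primitive:
  assumes "n \<ge> 2"
  shows "pderiv (chebyshev_T_primitive n) = chebyshev_T n"
proof (rule real_poly_eqI_interval)
  fix y :: real
  assume "-1 < y" "y < 1"
  then obtain \<theta> where y: "y = cos \<theta>" and \<theta>: "sin \<theta> \<noteq> 0"
    by (rule interval_cos)
  let ?P = "chebyshev_T_primitive n"
  have "(2::real) ^ 2 \<le> real n ^ 2"
    using assms by (intro power_mono) auto
  then have n: "real n ^ 2 - 1 \<noteq> 0" by simp
  have "((\<lambda>t. poly ?P (cos t)) has_real_derivative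
      poly (pderiv ?P) (cos \<theta>) * - sin \<theta>) (at \<theta>)"
    by (rule DERIV_chain2[OF poly_DERIV DERIV_cos])
  \<comment> \<open>The two products contribute n cos t sin (n t) with opposite signs; what remains
    is n^2 - 1 times sin t cos (n t).\<close>
  moreover have "((\<lambda>t. - (real n * sin t * sin (real n * t) + cos t * cos (real n * t) + (-1) ^ n)
      / (real n ^ 2 - 1)) has_real_derivative
      - ((real n ^ 2 - 1) * (sin \<theta> * cos (real n * \<theta>))) / (real n ^ 2 - 1)) (at \<theta>)"
    by (rule DERIV_cdivide)
      (auto intro!: derivative_eq_intros simp: algebra_simps power2_eq_square)
  ultimately have "poly (pderiv ?P) (cos \<theta>) * - sin \<theta> =
      - ((real n ^ 2 - 1) * (sin \<theta> * cos (real n * \<theta>))) / (real n ^ 2 - 1)"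
    using assms by (simp only: poly_chebyshev_T_primitive_cos) (rule DERIV_unique)
  also have "\<dots> = - (sin \<theta> * cos (real n * \<theta>))"
    using n by simp
  \<comment> \<open>Cancel -sin \<theta>, which is nonzero because y lies in the open
    interval.\<close>
  finally show "poly (pderiv ?P) y = poly (chebyshev_T n) y"
    using \<theta> by (simp add: y poly_chebyshev_T_cos)
qed

text \<open>The difference of the two sides has degree at most n but n + 1 zeros: the n roots of
  \<open>chebyshev_T n\<close> and the point 1. Since \<open>chebyshev_T n\<close> takes the value 1
  at 1, that point is not among the roots, and the factor can be read off there without leading
  coefficients.\<close>

lemma eq_smult_chebyshev_T:
  assumes "degree p \<le> n"
    and "card {r. poly (chebyshev_T n) r = 0} = n"
    and "\<And>r. poly (chebyshev_T n) r = 0 \<Longrightarrow> poly p r = 0"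
  shows "p = smult (poly p 1) (chebyshev_T n)"
proof (rule ccontr)
  define q where "q = p - smult (poly p 1) (chebyshev_T n)"
  let ?R = "{r. poly (chebyshev_T n) r = 0}"
  assume "p \<noteq> smult (poly p 1) (chebyshev_T n)"
  then have "q \<noteq> 0" by (simp add: q_def)
  have "chebyshev_T n \<noteq> 0"
    using poly_chebyshev_T_1[of n] by auto
  then have "finite ?R" by (rule poly_roots_finite)
  then have "Suc n = card (insert 1 ?R)"
    using assms(2) by (simp add: poly_chebyshev_T_1)
  also have "\<dots> \<le> card {r. poly q r = 0}"
    using assms(3) \<open>q \<noteq> 0\<close>
    by (intro card_mono poly_roots_finite) (auto simp: q_def poly_chebyshev_T_1)
  also have "\<dots> \<le> degree q"
    using \<open>q \<noteq> 0\<close> by (rule card_poly_roots_bound)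
  also have "\<dots> \<le> n"
    unfolding q_def using assms(1) degree_chebyshev_T_le
    by (intro degree_diff_le) (auto intro: order_trans[OF degree_smult_le])
  finally show False by simp
qed

text \<open>In characteristic 0 a zero derivative forces the difference to be constant, and its
  value at \<open>a\<close> is 0.\<close>

lemma poly_eqI_pderiv:
  fixes p q :: "'a :: {idom, ring_char_0} poly"
  assumes "pderiv p = pderiv q" and "poly p a = poly q a"
  shows "p = q"
proof -
  have "pderiv (p - q) = 0" using assms(1) by (simp add: pderiv_diff)
  then obtain b where "p - q = [:b:]"
    by (metis pderiv_iszero)
  moreover from this have "b = 0"
    using assms(2) by (metis poly_diff poly_pCons poly_0 diff_self mult_zero_right add_0_right)
  ultimately show ?thesis by simp
qed

theorem theorem3p4:
  fixes N :: nat and u u\<^sub>N :: "real poly" and x :: "nat \<Rightarrow> real"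
  assumes "N \<ge> 2"
    and "degree u \<le> N + 1"
    and "strict_mono_on {1..N} x"
    and "x ` {1..N} = {r. poly (chebyshev_T N) r = 0}"
    and "degree u\<^sub>N \<le> N"
    and "poly u\<^sub>N (-1) = poly u (-1)"
    and "\<And>k. k \<in> {1..N} \<Longrightarrow> poly (pderiv u\<^sub>N) (x k) = poly (pderiv u) (x k)"
  shows "\<exists>c::real. \<forall>y::real.
    poly (u - u\<^sub>N) y =
      c * (real N / (real N ^ 2 - 1) * (y ^ 2 - 1) * poly (chebyshev_U (N - 1)) y
           - (y * poly (chebyshev_T N) y + (-1) ^ N) / (real N ^ 2 - 1))"
proof -
  define c where "c = poly (pderiv (u - u\<^sub>N)) 1"
  \<comment> \<open>Strict monotonicity makes the nodes distinct, which supplies the root count for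
    \<open>eq_smult_chebyshev_T\<close>.\<close>
  have "inj_on x {1..N}"
    using assms(3) by (rule strict_mono_on_imp_inj_on)
  then have card: "card {r. poly (chebyshev_T N) r = 0} = N"
    using card_image[of x "{1..N}"] assms(4) by simp
  have "degree (u - u\<^sub>N) \<le> N + 1"
    using assms(2,5) by (intro degree_diff_le) auto
  then have deg: "degree (pderiv (u - u\<^sub>N)) \<le> N"
    by (simp add: degree_pderiv)
  have "poly (pderiv (u - u\<^sub>N)) r = 0" if "poly (chebyshev_T N) r = 0" for r
  proof -
    from that have "r \<in> x ` {1..N}" using assms(4) by blast
    then show ?thesis using assms(7) by (auto simp: pderiv_diff)
  qed
  then have "pderiv (u - u\<^sub>N) = smult c (chebyshev_T N)"
    unfolding c_def by (rule eq_smult_chebyshev_T[OF deg card])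
  then have "pderiv (u - u\<^sub>N) = pderiv (smult c (chebyshev_T_primitive N))"
    using assms(1) by (simp add: pderiv_smult pderiv_chebyshev_T_primitive)
  moreover have "poly (u - u\<^sub>N) (-1) = poly (smult c (chebyshev_T_primitive N)) (-1)"
    using assms(6) by (simp add: poly_chebyshev_T_primitive_minus_1)
  ultimately have "u - u\<^sub>N = smult c (chebyshev_T_primitive N)"
    by (rule poly_eqI_pderiv)
  then have "poly (u - u\<^sub>N) y = c * poly (chebyshev_T_primitive N) y" for y
    by simp
  then show ?thesis
    unfolding poly_chebyshev_T_primitive by blast
qed

end
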